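(* Let $n\ge 1$ and let $P\in\mathcal{P}^n_o$ be a $0$-symmetric lattice polytope with exactly $2n$ vertices. Then $$\mathrm{vol}(P)\ \geq\ \frac{2^{n-1}}{n!}\,\bigl(\mathrm{G}(\mathrm{int}\,P)+1\bigr).$$
   Context: $\mathcal{P}^n_o$ is the set of all convex lattice polytopes $P\subset\mathbb{R}^n$ (vertices in $\mathbb{Z}^n$, $\dim P=n$) that are $0$-symmetric, i.e., $P=-P$. For $S\subset\mathbb{R}^n$, $\mathrm{G}(S)=\#(S\cap\mathbb{Z}^n)$. $\mathrm{int}$ denotes the interior and $\mathrm{vol}$ the $n$-dimensional Lebesgue measure. *)

theory Defs
  imports "HOL-Analysis.Analysis"
begin

definition integer_lattice :: "(real ^ 'n) set" where
  "integer_lattice = {x. \<forall>i. x $ i \<in> \<int>}"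

definition vertices :: "(real ^ 'n) set \<Rightarrow> (real ^ 'n) set" where
  "vertices P = {x. x extreme_point_of P}"

definition lattice_polytope :: "(real ^ 'n) set \<Rightarrow> bool" where
  "lattice_polytope P \<longleftrightarrow>
     polytope P \<and> vertices P \<subseteq> integer_lattice \<and> aff_dim P = int CARD('n)"

definition symmetric_lattice_polytopes :: "(real ^ 'n) set set" where
  "symmetric_lattice_polytopes = {P. lattice_polytope P \<and> uminus ` P = P}"

text \<open>The cardinality is only meaningful for sets with finitely many lattice points,
  e.g. bounded sets; \<^const>\<open>card\<close> is 0 on infinite sets.\<close>

definition lattice_point_count :: "(real ^ 'n) set \<Rightarrow> nat" where
  "lattice_point_count S = card (S \<inter> integer_lattice)"

end

theory Submission
  imports Defs
begin

text \<open>
A symmetric polytope of full dimension with \<open>2n\<close> vertices is a linear image of the standard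
cross-polytope: its vertices contain a basis \<open>v\<^sub>1, \<dots>, v\<^sub>n\<close>, and together with the negatives these are
already all of them (\<open>symmetric_spanning_set_eq_basis_Un\<close>). Let \<open>f\<close> be the linear map with
\<open>f e\<^sub>i = v\<^sub>i\<close> and let \<open>d = vol (f [0,1)\<^sup>n)\<close> be the volume of the fundamental cell of the lattice
\<open>\<Lambda> = f \<int>\<^sup>n \<subseteq> \<int>\<^sup>n\<close>. The standard cross-polytope consists of \<open>2\<^sup>n\<close> reflected simplices
of volume \<open>1 / n!\<close>, so that \<open>vol P \<ge> 2\<^sup>n d / n!\<close>, and the claim reduces to the count
\<open>G(int P) \<le> 2 d - 1\<close>.

For the count, sort the integer points into classes modulo \<open>\<Lambda>\<close>. There are at most \<open>d\<close> classes,
because unit cubes placed at incongruent integer points can be cut and moved into the fundamental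
cell without overlap (\<open>card_incongruent_le_measure_cell\<close>). In the coordinates given by the basis, the
interior of \<open>P\<close> is the open unit ball of the \<open>\<ell>\<^sub>1\<close>-norm, so two different congruent interior points differ by
some \<open>\<plusminus>e\<^sub>i\<close>. Such a difference has odd coordinate sum, so a class cannot contain three interior
points (\<open>no_three_congruent_points\<close>), and the only interior point congruent to 0 is 0. This leaves
at most \<open>1 + 2 (d - 1)\<close> points.

Volumes of linear images are handled by one scaling law (\<open>linear_image_scales_measure\<close>), which
compares the image of a measurable set with that of a compact symmetric reference body.
\<close>

section \<open>Linear maps scale volume by a constant factor\<close>

lemma nn_integral_lborel_translation:
  fixes h :: "'a::euclidean_space \<Rightarrow> ennreal"
  assumes [measurable]: "h \<in> borel_measurable borel"
  shows "(\<integral>\<^sup>+ y. h (c + y) \<partial>lborel) = (\<integral>\<^sup>+ y. h y \<partial>lborel)"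
proof -
  have "(\<integral>\<^sup>+ y. h y \<partial>lborel) = (\<integral>\<^sup>+ y. h y \<partial>distr lborel borel ((+) c))"
    by (simp add: lborel_distr_plus)
  also have "\<dots> = (\<integral>\<^sup>+ y. h (c + y) \<partial>lborel)"
    by (subst nn_integral_distr) simp_all
  finally show ?thesis by simp
qed

text \<open>This is the uniqueness argument for translation-invariant measures, applied to Lebesgue
measure and to its pushforward \<open>S \<mapsto> vol (f S)\<close> under the inverse \<open>g\<close> of \<open>f\<close>. The double integral
of \<open>1\<^sub>A(g x) 1\<^sub>B(y - g x)\<close> is evaluated twice: integrating over \<open>y\<close> first gives the left-hand
side, while the substitution \<open>x \<mapsto> f y + x\<close>, followed by the symmetry of \<open>B\<close> and integration over
\<open>y\<close>, gives the right-hand side.\<close>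

lemma emeasure_linear_image_exchange:
  fixes f :: "'a::euclidean_space \<Rightarrow> 'a"
  assumes "linear f" "inj f"
    and A [measurable]: "A \<in> sets borel" and B [measurable]: "B \<in> sets borel" and sym: "uminus ` B = B"
  shows "emeasure lborel (f ` A) * emeasure lborel B = emeasure lborel A * emeasure lborel (f ` B)"
proof -
  obtain g where g: "linear g" "\<And>x. g (f x) = x" "\<And>x. f (g x) = x"
    using linear_injective_isomorphism[OF assms(1,2)] by auto
  have [measurable]: "g \<in> borel_measurable borel"
    using g(1) by (intro borel_measurable_continuous_onI linear_continuous_on)
      (simp add: linear_conv_bounded_linear)
  have pre: "f ` S = g -` S" for S
    using g by (auto simp: image_iff) (metis g(3))
  have minus: "- x \<in> B \<longleftrightarrow> x \<in> B" for x
    using sym by (metis image_eqI minus_minus)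
  have meas: "f ` S \<in> sets borel" if "S \<in> sets borel" for S
    unfolding pre using measurable_sets[of g borel borel S] that by simp
  have ind: "emeasure lborel (f ` S) = (\<integral>\<^sup>+ x. indicator S (g x) \<partial>lborel)" if S: "S \<in> sets borel" for S
  proof -
    have "(\<integral>\<^sup>+ x. indicator S (g x) \<partial>lborel) = (\<integral>\<^sup>+ x. indicator (f ` S) x \<partial>lborel)"
      unfolding pre by (intro nn_integral_cong) (auto simp: indicator_def)
    then show ?thesis
      using meas[OF S] by simp
  qed
  have "emeasure lborel (f ` A) * emeasure lborel B
      = (\<integral>\<^sup>+ x. indicator A (g x) * emeasure lborel B \<partial>lborel)"
    using ind[OF A] by (simp add: nn_integral_multc)
  also have "\<dots> = (\<integral>\<^sup>+ x. (\<integral>\<^sup>+ y. indicator A (g x) * indicator B (y - g x) \<partial>lborel) \<partial>lborel)"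
  proof (rule nn_integral_cong)
    fix x
    have "(\<integral>\<^sup>+ y. indicator B (y - g x) \<partial>lborel) = (\<integral>\<^sup>+ y. indicator B y \<partial>lborel)"
      using nn_integral_lborel_translation[of "indicator B" "- g x"] by simp
    then show "indicator A (g x) * emeasure lborel B
        = (\<integral>\<^sup>+ y. indicator A (g x) * indicator B (y - g x) \<partial>lborel)"
      by (simp add: nn_integral_cmult)
  qed
  also have "\<dots> = (\<integral>\<^sup>+ y. (\<integral>\<^sup>+ x. indicator A (g x) * indicator B (y - g x) \<partial>lborel) \<partial>lborel)"
    by (intro lborel_pair.Fubini'[symmetric]) simp
  \<comment> \<open>The substitution \<open>x \<mapsto> f y + x\<close>; the argument of \<open>indicator B\<close> becomes \<open>- g x\<close>.\<close>
  also have "\<dots> = (\<integral>\<^sup>+ y. (\<integral>\<^sup>+ x. indicator A (y + g x) * indicator B (g x) \<partial>lborel) \<partial>lborel)"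
  proof (rule nn_integral_cong)
    fix y
    have "(\<integral>\<^sup>+ x. indicator A (g x) * indicator B (y - g x) \<partial>lborel)
        = ((\<integral>\<^sup>+ x. indicator A (g (f y + x)) * indicator B (y - g (f y + x)) \<partial>lborel) :: ennreal)"
      using nn_integral_lborel_translation[of "\<lambda>x. indicator A (g x) * indicator B (y - g x)" "f y"]
      by simp
    also have "\<dots> = (\<integral>\<^sup>+ x. indicator A (y + g x) * indicator B (g x) \<partial>lborel)"
      by (intro nn_integral_cong) (simp add: linear_add[OF g(1)] g(2) indicator_def minus)
    finally show "(\<integral>\<^sup>+ x. indicator A (g x) * indicator B (y - g x) \<partial>lborel)
        = ((\<integral>\<^sup>+ x. indicator A (y + g x) * indicator B (g x) \<partial>lborel) :: ennreal)" .
  qed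
  also have "\<dots> = (\<integral>\<^sup>+ x. (\<integral>\<^sup>+ y. indicator A (y + g x) * indicator B (g x) \<partial>lborel) \<partial>lborel)"
    by (intro lborel_pair.Fubini') simp
  also have "\<dots> = (\<integral>\<^sup>+ x. emeasure lborel A * indicator B (g x) \<partial>lborel)"
  proof (rule nn_integral_cong)
    fix x
    have "(\<integral>\<^sup>+ y. indicator A (y + g x) \<partial>lborel) = (\<integral>\<^sup>+ y. indicator A y \<partial>lborel)"
      using nn_integral_lborel_translation[of "indicator A" "g x"] by (simp add: add.commute)
    then show "(\<integral>\<^sup>+ y. indicator A (y + g x) * indicator B (g x) \<partial>lborel)
        = emeasure lborel A * indicator B (g x)"
      by (simp add: nn_integral_multc)
  qed
  also have "\<dots> = emeasure lborel A * emeasure lborel (f ` B)"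
    using ind[OF B] by (simp add: nn_integral_cmult)
  finally show ?thesis .
qed

text \<open>The scaling factor is expressed through the image of one symmetric reference body \<open>B\<close> and not
through a determinant, because below only the volumes of two images under the same map, of the
cross-polytope and of the unit cube, are compared.\<close>

lemma linear_image_scales_measure:
  fixes f :: "'a::euclidean_space \<Rightarrow> 'a"
  assumes "linear f" "inj f"
    and B: "compact B" "uminus ` B = B" "measure lebesgue B > 0" and S: "S \<in> lmeasurable"
  shows "f ` S \<in> lmeasurable"
    and "measure lebesgue (f ` S) = measure lebesgue (f ` B) / measure lebesgue B * measure lebesgue S"
proof -
  have em: "emeasure lborel K = ennreal (measure lebesgue K)" if "compact K" for K :: "'a set"
    using that emeasure_eq_measure2[OF lmeasurable_compact[OF that]]
    by (simp add: borel_compact)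
  have fK: "compact (f ` K)" if "compact K" for K
    using that \<open>linear f\<close> by (intro compact_continuous_image linear_continuous_on)
      (auto simp: linear_conv_bounded_linear)
  have "measure lebesgue (f ` cbox a b)
      = measure lebesgue (f ` B) / measure lebesgue B * measure lebesgue (cbox a b)" for a b
  proof -
    have "ennreal (measure lebesgue (f ` cbox a b) * measure lebesgue B)
        = ennreal (measure lebesgue (cbox a b) * measure lebesgue (f ` B))"
      using emeasure_linear_image_exchange[OF assms(1,2), of "cbox a b" B] B fK
      by (simp add: borel_compact em[OF compact_cbox] em[OF fK[OF compact_cbox]] em ennreal_mult' del: emeasure_lborel_cbox)
    then have "measure lebesgue (f ` cbox a b) * measure lebesgue B
        = measure lebesgue (cbox a b) * measure lebesgue (f ` B)"
      by (subst (asm) ennreal_inj) auto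
    then show ?thesis
      using B(3) by (simp add: field_simps)
  qed
  from measure_linear_sufficient[OF assms(1) S this]
  show "f ` S \<in> lmeasurable"
    and "measure lebesgue (f ` S) = measure lebesgue (f ` B) / measure lebesgue B * measure lebesgue S"
    by auto
qed

section \<open>Integer points and the fundamental cell of a sublattice\<close>

definition half_open_unit_cube :: "(real ^ 'n) set" where
  "half_open_unit_cube = {x. \<forall>i. 0 \<le> x $ i \<and> x $ i < 1}"

lemma half_open_unit_cube_lmeasurable: "(half_open_unit_cube :: (real ^ 'n) set) \<in> lmeasurable"
  and measure_half_open_unit_cube: "measure lebesgue (half_open_unit_cube :: (real ^ 'n) set) = 1"
proof -
  let ?U = "half_open_unit_cube :: (real ^ 'n) set"
  have "?U = (\<Inter>i. {x. 0 \<le> x $ i} \<inter> {x. x $ i < 1})"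
    by (auto simp: half_open_unit_cube_def)
  also have "\<dots> \<in> sets borel"
    by (intro sets.countable_INT') (auto intro!: sets.Int[OF borel_closed borel_open]
        closed_halfspace_component_ge_cart open_halfspace_component_lt_cart)
  finally have U: "?U \<in> sets lebesgue" by simp
  have sub: "box 0 1 \<subseteq> ?U" "?U \<subseteq> cbox 0 1"
    by (auto simp: half_open_unit_cube_def mem_box_cart less_imp_le)
  show L: "?U \<in> lmeasurable"
    by (rule fmeasurableI2[OF lmeasurable_cbox sub(2) U])
  have "b \<in> Basis \<Longrightarrow> 1 \<bullet> b = 1" for b :: "real ^ 'n"
    by (auto simp: Basis_vec_def inner_axis)
  then have "measure lebesgue (box 0 (1::real^'n)) = 1" "measure lebesgue (cbox 0 (1::real^'n)) = 1"
    by (simp_all add: measure_lborel_cbox_eq measure_lborel_box_eq)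
  then show "measure lebesgue ?U = 1"
    using measure_mono_fmeasurable[OF sub(1) _ L] measure_mono_fmeasurable[OF sub(2) U lmeasurable_cbox]
    by (metis antisym fmeasurableD lmeasurable_box)
qed

lemma countable_integer_lattice: "countable (integer_lattice :: (real ^ 'n) set)"
proof -
  have "integer_lattice \<subseteq> range (\<lambda>k. \<chi> i::'n. real_of_int (k i))"
  proof
    fix x :: "real ^ 'n" assume "x \<in> integer_lattice"
    then have "x = (\<chi> i. real_of_int \<lfloor>x $ i\<rfloor>)"
      by (simp add: integer_lattice_def vec_eq_iff)
    then show "x \<in> range (\<lambda>k. \<chi> i::'n. real_of_int (k i))"
      by (rule range_eqI[where x="\<lambda>i. \<lfloor>x $ i\<rfloor>"])
  qed
  then show ?thesis
    by (rule countable_subset) simp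
qed

lemma integer_lattice_diff: "x \<in> integer_lattice \<Longrightarrow> y \<in> integer_lattice \<Longrightarrow> x - y \<in> integer_lattice"
  and integer_lattice_add: "x \<in> integer_lattice \<Longrightarrow> y \<in> integer_lattice \<Longrightarrow> x + y \<in> integer_lattice"
  and integer_lattice_zero: "0 \<in> integer_lattice"
  by (auto simp: integer_lattice_def)

lemma half_open_unit_cube_integer_diff:
  assumes "u \<in> half_open_unit_cube" "w \<in> half_open_unit_cube" "u - w \<in> integer_lattice"
  shows "u = w"
proof -
  have "u $ i = w $ i" for i
  proof -
    have "u $ i - w $ i \<in> \<int>"
      using assms(3) by (simp add: integer_lattice_def)
    moreover have "\<bar>u $ i - w $ i\<bar> < 1"
    proof -
      have "0 \<le> u $ i" "u $ i < 1" "0 \<le> w $ i" "w $ i < 1"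
        using assms(1,2) by (auto simp: half_open_unit_cube_def)
      then show ?thesis by linarith
    qed
    ultimately show ?thesis
      using Ints_nonzero_abs_less1 by fastforce
  qed
  then show ?thesis by (simp add: vec_eq_iff)
qed

lemma half_open_unit_cube_decomposition:
  obtains k u where "k \<in> integer_lattice" "u \<in> half_open_unit_cube" "x = k + u"
proof
  show "(\<chi> i. of_int \<lfloor>x $ i\<rfloor>) \<in> integer_lattice"
    by (simp add: integer_lattice_def)
  show "(\<chi> i. frac (x $ i)) \<in> half_open_unit_cube"
    by (simp add: half_open_unit_cube_def frac_lt_1)
  show "x = (\<chi> i. of_int \<lfloor>x $ i\<rfloor>) + (\<chi> i. frac (x $ i))"
    by (simp add: vec_eq_iff frac_def)
qed

text \<open>Cut \<open>W\<close> along the translates of the cell \<open>f [0,1)\<^sup>n\<close> by the lattice \<open>f \<int>\<^sup>n\<close>, which tile space, and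
move all pieces back into the cell. The packing hypothesis says precisely that the moved pieces
do not overlap, so their total volume is at most that of the cell.\<close>

lemma measure_le_fundamental_cell:
  fixes f :: "real ^ 'n \<Rightarrow> real ^ 'n"
  assumes f: "linear f" "inj f" and cell: "f ` half_open_unit_cube \<in> lmeasurable"
    and W: "W \<in> lmeasurable"
    and packing: "\<And>v w. v \<in> W \<Longrightarrow> w \<in> W \<Longrightarrow> v - w \<in> f ` integer_lattice \<Longrightarrow> v = w"
  shows "measure lebesgue W \<le> measure lebesgue (f ` half_open_unit_cube)"
proof -
  let ?Q = "f ` half_open_unit_cube" and ?L = "integer_lattice :: (real ^ 'n) set"
  define X where "X k = W \<inter> (+) (f k) ` ?Q" for k
  define Y where "Y k = (+) (f (- k)) ` X k" for k
  have fk: "f (- k) + f k = 0" for k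
    using f(1) by (simp add: linear_neg)
  have X: "X k \<in> lmeasurable" for k
    unfolding X_def using W cell measurable_translation by blast
  have Y: "Y k \<in> lmeasurable" for k
    unfolding Y_def using X measurable_translation by blast
  have W_eq: "W = (\<Union>k\<in>?L. X k)"
  proof -
    have "w \<in> (\<Union>k\<in>?L. X k)" if w: "w \<in> W" for w
    proof -
      have "surj f"
        using f linear_injective_imp_surjective by blast
      then obtain x where x: "w = f x" by (metis surjD)
      obtain k u where ku: "k \<in> ?L" "u \<in> half_open_unit_cube" "x = k + u"
        by (rule half_open_unit_cube_decomposition)
      then have "w = f k + f u"
        using x f(1) by (simp add: linear_add)
      then show ?thesis
        using w ku by (auto simp: X_def)
    qed
    then show ?thesis by (auto simp: X_def)
  qed
  have disjX: "disjoint_family_on X ?L"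
  proof (unfold disjoint_family_on_def, intro ballI impI, rule ccontr)
    fix k l assume kl: "k \<in> ?L" "l \<in> ?L" "k \<noteq> l" "X k \<inter> X l \<noteq> {}"
    then obtain u v where uv: "u \<in> half_open_unit_cube" "v \<in> half_open_unit_cube" "f k + f u = f l + f v"
      by (auto simp: X_def)
    then have *: "k + u = l + v"
      using f by (metis linear_add injD)
    then have "u - v = l - k" by (simp add: algebra_simps)
    then have "u = v"
      using half_open_unit_cube_integer_diff[OF uv(1,2)] kl integer_lattice_diff by metis
    with * kl show False by simp
  qed
  have disjY: "disjoint_family_on Y ?L"
  proof (unfold disjoint_family_on_def, intro ballI impI, rule ccontr)
    fix k l assume kl: "k \<in> ?L" "l \<in> ?L" "k \<noteq> l" "Y k \<inter> Y l \<noteq> {}"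
    then obtain v w where vw: "v \<in> W" "w \<in> W" "f (- k) + v = f (- l) + w"
      by (auto simp: Y_def X_def)
    then have "v - w = f (k - l)"
      using f(1) by (simp add: linear_neg linear_diff algebra_simps)
    moreover have "k - l \<in> ?L" using kl integer_lattice_diff by blast
    ultimately have "v = w" using packing vw by blast
    with vw have "f (- k) = f (- l)" by simp
    then show False using f(2) kl by (simp add: inj_eq)
  qed
  have XY: "emeasure lebesgue (X k) = emeasure lebesgue (Y k)" for k
    using emeasure_eq_measure2[OF X] emeasure_eq_measure2[OF Y] by (simp add: Y_def measure_translation)
  have "emeasure lebesgue W = (\<integral>\<^sup>+k. emeasure lebesgue (X k) \<partial>count_space ?L)"
    unfolding W_eq using X disjX countable_integer_lattice
    by (intro emeasure_UN_countable) auto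
  also have "\<dots> = emeasure lebesgue (\<Union>k\<in>?L. Y k)"
    unfolding XY using Y disjY countable_integer_lattice
    by (intro emeasure_UN_countable[symmetric]) auto
  also have "\<dots> \<le> emeasure lebesgue ?Q"
  proof (intro emeasure_mono)
    show "(\<Union>k\<in>?L. Y k) \<subseteq> ?Q"
      by (auto simp: Y_def X_def add.assoc[symmetric] fk)
  qed (use cell in auto)
  finally show ?thesis
    using W cell by (simp add: emeasure_eq_measure2)
qed

text \<open>The unit cubes at the points of \<open>T\<close> stay disjoint modulo \<open>f \<int>\<^sup>n\<close>: if two points in these cubes
differ by an element of \<open>f \<int>\<^sup>n\<close>, which is an integer vector, then they have the same fractional parts,
and so their corners are congruent. Hence the packing bound applies to the
union of the cubes. In terms of groups, the index of the sublattice \<open>f \<int>\<^sup>n\<close> is at most \<open>|det f|\<close>.\<close>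

lemma card_incongruent_le_measure_cell:
  fixes f :: "real ^ 'n \<Rightarrow> real ^ 'n"
  assumes f: "linear f" "inj f" and cell: "f ` half_open_unit_cube \<in> lmeasurable"
    and lattice: "f ` integer_lattice \<subseteq> integer_lattice"
    and T: "finite T" "T \<subseteq> integer_lattice"
    and incongruent: "\<And>x y. x \<in> T \<Longrightarrow> y \<in> T \<Longrightarrow> x - y \<in> f ` integer_lattice \<Longrightarrow> x = y"
  shows "real (card T) \<le> measure lebesgue (f ` half_open_unit_cube)"
proof -
  let ?U = "half_open_unit_cube :: (real ^ 'n) set"
  define W where "W = (\<Union>x\<in>T. (+) x ` ?U)"
  have cube: "(+) x ` ?U \<in> lmeasurable" for x
    by (intro measurable_translation half_open_unit_cube_lmeasurable)
  have W: "W \<in> lmeasurable"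
    unfolding W_def using T(1) cube by (intro fmeasurable.finite_UN) auto
  have cong: "x = y \<and> u = v"
    if "x \<in> T" "y \<in> T" "u \<in> ?U" "v \<in> ?U" and d: "(x + u) - (y + v) \<in> f ` integer_lattice" for x y u v
  proof -
    have "u - v = ((x + u) - (y + v)) - (x - y)" by simp
    also have "\<dots> \<in> integer_lattice"
    proof (rule integer_lattice_diff)
      show "(x + u) - (y + v) \<in> integer_lattice" using d lattice by (rule subsetD[rotated])
      show "x - y \<in> integer_lattice" using T(2) that by (intro integer_lattice_diff) auto
    qed
    finally have "u = v"
      using half_open_unit_cube_integer_diff that by blast
    then show ?thesis
      using incongruent[of x y] that by auto
  qed
  have f0: "0 \<in> f ` integer_lattice"
    using integer_lattice_zero linear_0[OF f(1)] by (metis image_eqI)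
  have "measure lebesgue W = (\<Sum>x\<in>T. measure lebesgue ((+) x ` ?U))"
    unfolding W_def
  proof (rule measure_finite_Union[OF T(1)])
    show "disjoint_family_on (\<lambda>x. (+) x ` ?U) T"
    proof (unfold disjoint_family_on_def, intro ballI impI, rule ccontr)
      fix x y assume xy: "x \<in> T" "y \<in> T" "x \<noteq> y" "(+) x ` ?U \<inter> (+) y ` ?U \<noteq> {}"
      then obtain u v where uv: "u \<in> ?U" "v \<in> ?U" "x + u = y + v" by blast
      then have "x + u - (y + v) \<in> f ` integer_lattice" using f0 by simp
      then show False using cong[OF xy(1,2) uv(1,2)] xy by blast
    qed
    show "emeasure lebesgue ((+) x ` ?U) \<noteq> \<infinity>" for x
      using emeasure_eq_measure2[OF cube] by simp
  qed (use cube in auto)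
  then have "real (card T) = measure lebesgue W"
    by (simp add: measure_translation measure_half_open_unit_cube)
  also have "\<dots> \<le> measure lebesgue (f ` ?U)"
  proof (rule measure_le_fundamental_cell[OF f cell W])
    fix v w assume "v \<in> W" "w \<in> W" "v - w \<in> f ` integer_lattice"
    then show "v = w" unfolding W_def using cong by blast
  qed
  finally show ?thesis .
qed

section \<open>Congruent lattice points inside a cross-polytope\<close>

text \<open>A nonzero integer vector of \<open>\<ell>\<^sub>1\<close>-norm below 2 has norm 1, and the coordinate sum has the
same parity as the norm.\<close>

lemma odd_sum_of_short_integer_vector:
  fixes k :: "real ^ 'n"
  assumes k: "k \<in> integer_lattice" "k \<noteq> 0" "(\<Sum>i\<in>UNIV. \<bar>k $ i\<bar>) < 2"
  obtains m :: int where "odd m" "(\<Sum>i\<in>UNIV. k $ i) = of_int m"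
proof
  define g where "g i = \<lfloor>k $ i\<rfloor>" for i
  have g: "k $ i = of_int (g i)" for i
    using k(1) by (simp add: g_def integer_lattice_def)
  obtain j where "k $ j \<noteq> 0"
    using k(2) by (metis vec_eq_iff zero_index)
  then have "0 < \<bar>g j\<bar>" by (simp add: g)
  also have "\<dots> \<le> (\<Sum>i\<in>UNIV. \<bar>g i\<bar>)"
    by (rule member_le_sum) auto
  finally have "0 < (\<Sum>i\<in>UNIV. \<bar>g i\<bar>)" .
  moreover have "real_of_int (\<Sum>i\<in>UNIV. \<bar>g i\<bar>) < 2"
    using k(3) by (simp add: g)
  ultimately have "(\<Sum>i\<in>UNIV. \<bar>g i\<bar>) = 1"
    by linarith
  then have "odd (\<Sum>i\<in>UNIV. \<bar>g i\<bar>)" by simp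
  then show "odd (\<Sum>i\<in>UNIV. g i)"
    by (simp add: even_sum_iff)
  show "(\<Sum>i\<in>UNIV. k $ i) = of_int (\<Sum>i\<in>UNIV. g i)"
    by (simp add: g)
qed

text \<open>The three pairwise differences of such points would have odd coordinate sums, although one
difference is the sum of the other two.\<close>

lemma no_three_congruent_points:
  fixes a b c :: "real ^ 'n"
  assumes a: "(\<Sum>i\<in>UNIV. \<bar>a $ i\<bar>) < 1" and b: "(\<Sum>i\<in>UNIV. \<bar>b $ i\<bar>) < 1" and c: "(\<Sum>i\<in>UNIV. \<bar>c $ i\<bar>) < 1"
    and cong: "a - b \<in> integer_lattice" "b - c \<in> integer_lattice"
    and ne: "a \<noteq> b" "b \<noteq> c" "a \<noteq> c"
  shows False
proof -
  have short: "(\<Sum>i\<in>UNIV. \<bar>(x - y) $ i\<bar>) < 2"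
    if "(\<Sum>i\<in>UNIV. \<bar>x $ i\<bar>) < 1" "(\<Sum>i\<in>UNIV. \<bar>y $ i\<bar>) < 1" for x y :: "real ^ 'n"
  proof -
    have "(\<Sum>i\<in>UNIV. \<bar>(x - y) $ i\<bar>) \<le> (\<Sum>i\<in>UNIV. \<bar>x $ i\<bar> + \<bar>y $ i\<bar>)"
      by (intro sum_mono) (simp add: abs_triangle_ineq4)
    then show ?thesis using that by (simp add: sum.distrib)
  qed
  have "a - c = (a - b) + (b - c)" by simp
  then have ac: "a - c \<in> integer_lattice"
    using cong integer_lattice_add by metis
  obtain m1 where m1: "odd m1" "(\<Sum>i\<in>UNIV. (a - b) $ i) = of_int m1"
    using odd_sum_of_short_integer_vector[OF cong(1) _ short[OF a b]] ne by auto
  obtain m2 where m2: "odd m2" "(\<Sum>i\<in>UNIV. (b - c) $ i) = of_int m2"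
    using odd_sum_of_short_integer_vector[OF cong(2) _ short[OF b c]] ne by auto
  obtain m3 where m3: "odd m3" "(\<Sum>i\<in>UNIV. (a - c) $ i) = of_int m3"
    using odd_sum_of_short_integer_vector[OF ac _ short[OF a c]] ne by auto
  have "real_of_int m3 = of_int (m1 + m2)"
    using m1(2) m2(2) m3(2) by (simp add: sum_subtractf)
  then have "m3 = m1 + m2" by linarith
  with m1 m2 m3 show False by simp
qed

lemma integer_vector_short_eq_0:
  fixes k :: "real ^ 'n"
  assumes "k \<in> integer_lattice" "(\<Sum>i\<in>UNIV. \<bar>k $ i\<bar>) < 1"
  shows "k = 0"
proof -
  have "k $ i = 0" for i
  proof (rule Ints_nonzero_abs_less1)
    show "k $ i \<in> \<int>" using assms(1) by (simp add: integer_lattice_def)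
    have "\<bar>k $ i\<bar> \<le> (\<Sum>i\<in>UNIV. \<bar>k $ i\<bar>)" by (rule member_le_sum) auto
    then show "\<bar>k $ i\<bar> < 1" using assms(2) by simp
  qed
  then show ?thesis by (simp add: vec_eq_iff)
qed

text \<open>Sort the points by their class modulo \<open>f \<int>\<^sup>n\<close>. Every class contains at most two of them, the class
of 0 only 0 itself, and there are at most \<open>d = vol (f [0,1)\<^sup>n)\<close> classes. So there are at most
\<open>1 + 2 (d - 1)\<close> points.\<close>

lemma card_interior_lattice_points_le:
  fixes f :: "real ^ 'n \<Rightarrow> real ^ 'n"
  assumes f: "linear f" "inj f" and cell: "f ` half_open_unit_cube \<in> lmeasurable"
    and lattice: "f ` integer_lattice \<subseteq> integer_lattice"
    and S: "finite S" "S \<subseteq> integer_lattice" "S \<subseteq> f ` {a. (\<Sum>i\<in>UNIV. \<bar>a $ i\<bar>) < 1}"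
  shows "real (card S) + 1 \<le> 2 * measure lebesgue (f ` half_open_unit_cube)"
proof -
  let ?L = "integer_lattice :: (real ^ 'n) set"
  have diff: "x - y \<in> f ` ?L" if "x \<in> f ` ?L" "y \<in> f ` ?L" for x y
    using that f(1) integer_lattice_diff by (auto simp: linear_diff[symmetric] intro!: imageI)
  have zero: "0 \<in> f ` ?L"
    using integer_lattice_zero linear_0[OF f(1)] by (metis image_eqI)
  have minus: "- x \<in> f ` ?L" if "x \<in> f ` ?L" for x
    using diff[OF zero that] by simp
  have pull: "a - b \<in> ?L" if "f a - f b \<in> f ` ?L" for a b
    using that f by (auto simp: linear_diff[symmetric] inj_eq)
  define rep where "rep x = (SOME y. x - y \<in> f ` ?L)" for x
  have rep: "x - rep x \<in> f ` ?L" for x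
    unfolding rep_def by (rule someI[of _ x]) (simp add: zero)
  have rep_cong: "rep x = rep y" if "x - y \<in> f ` ?L" for x y
  proof -
    have "x - z \<in> f ` ?L \<longleftrightarrow> y - z \<in> f ` ?L" for z
      using diff[of "x - z" "x - y"] diff[of "x - y" "- (y - z)"] minus[of "y - z"] that by auto
    then show ?thesis by (simp add: rep_def)
  qed
  have cong_rep: "x - y \<in> f ` ?L" if "rep x = rep y" for x y
    using diff[OF rep[of x] rep[of y]] that by simp
  \<comment> \<open>The class of 0 is included even if 0 is not in \<open>S\<close>: it accounts for the gain of 1.\<close>
  define T where "T = rep ` insert 0 S"
  have "finite T" using S(1) by (simp add: T_def)
  have T: "real (card T) \<le> measure lebesgue (f ` half_open_unit_cube)"
  proof (rule card_incongruent_le_measure_cell[OF f cell lattice \<open>finite T\<close>])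
    show "T \<subseteq> ?L"
    proof
      fix t assume "t \<in> T"
      then obtain x where x: "x \<in> ?L" "t = rep x"
        using S(2) integer_lattice_zero by (auto simp: T_def)
      then have "x - t \<in> ?L"
        using rep[of x] lattice by auto
      then have "x - (x - t) \<in> ?L"
        using x(1) by (rule integer_lattice_diff[rotated])
      then show "t \<in> ?L" by simp
    qed
    fix x y assume xy: "x \<in> T" "y \<in> T" "x - y \<in> f ` ?L"
    have idem: "rep t = t" if "t \<in> T" for t
      using that rep_cong[OF rep] by (auto simp: T_def)
    show "x = y" using rep_cong[OF xy(3)] idem xy by simp
  qed
  define F where "F t = {x \<in> S. rep x = t}" for t
  have finF: "finite (F t)" for t using S(1) by (simp add: F_def)
  have F2: "card (F t) \<le> 2" for t
  proof (rule ccontr)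
    assume "\<not> card (F t) \<le> 2"
    then obtain G where "G \<subseteq> F t" "card G = 3"
      using obtain_subset_with_card_n[of 3 "F t"] by auto
    then obtain x y z where xyz: "x \<in> F t" "y \<in> F t" "z \<in> F t" "x \<noteq> y" "y \<noteq> z" "x \<noteq> z"
      by (auto simp: card_3_iff)
    then obtain a b c where abc: "x = f a" "y = f b" "z = f c"
        "(\<Sum>i\<in>UNIV. \<bar>a $ i\<bar>) < 1" "(\<Sum>i\<in>UNIV. \<bar>b $ i\<bar>) < 1" "(\<Sum>i\<in>UNIV. \<bar>c $ i\<bar>) < 1"
      using S(3) by (auto simp: F_def) blast
    have "f a - f b \<in> f ` ?L" "f b - f c \<in> f ` ?L"
      using cong_rep xyz abc(1-3) by (auto simp: F_def)
    then show False
      using no_three_congruent_points[OF abc(4-6) pull pull] xyz abc(1-3) by auto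
  qed
  have "F (rep 0) \<subseteq> {0}"
  proof
    fix x assume x: "x \<in> F (rep 0)"
    then obtain a where a: "x = f a" "(\<Sum>i\<in>UNIV. \<bar>a $ i\<bar>) < 1"
      using S(3) by (auto simp: F_def)
    have "f a - f 0 \<in> f ` ?L"
      using cong_rep[of x 0] x a linear_0[OF f(1)] by (simp add: F_def)
    then have "a = 0"
      using pull[of a 0] integer_vector_short_eq_0 a by simp
    then show "x \<in> {0}" using a linear_0[OF f(1)] by simp
  qed
  then have F1: "card (F (rep 0)) \<le> 1"
    using card_mono[of "{0}" "F (rep 0)"] by simp
  have "S = (\<Union>t\<in>T. F t)" by (auto simp: F_def T_def)
  then have "card S \<le> (\<Sum>t\<in>T. card (F t))"
    using card_UN_le[OF \<open>finite T\<close>] by metis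
  also have "\<dots> = card (F (rep 0)) + (\<Sum>t\<in>T - {rep 0}. card (F t))"
    by (rule sum.remove[OF \<open>finite T\<close>]) (simp add: T_def)
  also have "\<dots> \<le> 1 + (\<Sum>t\<in>T - {rep 0}. 2)"
    by (intro add_mono F1 sum_mono F2)
  also have "\<dots> = 1 + 2 * (card T - 1)"
  proof -
    have "rep 0 \<in> T" by (simp add: T_def)
    then show ?thesis by (simp add: card_Diff_singleton)
  qed
  finally have "card S \<le> 1 + 2 * (card T - 1)" .
  moreover have "card T > 0"
    using \<open>finite T\<close> by (auto simp: T_def card_gt_0_iff)
  ultimately have "card S + 1 \<le> 2 * card T" by linarith
  then have "real (card S) + 1 \<le> 2 * real (card T)" by linarith
  then show ?thesis using T by linarith
qed

section \<open>The standard cross-polytope\<close>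

definition cross_polytope :: "(real ^ 'n) set" where
  "cross_polytope = {x. (\<Sum>i\<in>UNIV. \<bar>x $ i\<bar>) \<le> 1}"

lemma compact_cross_polytope: "compact (cross_polytope :: (real ^ 'n) set)"
proof -
  have "closed (cross_polytope :: (real ^ 'n) set)"
    unfolding cross_polytope_def by (intro closed_Collect_le continuous_intros)
  moreover have "cross_polytope \<subseteq> cball (0 :: real ^ 'n) 1"
    by (auto simp: cross_polytope_def intro: order_trans[OF norm_le_l1_cart])
  ultimately show ?thesis
    using compact_eq_bounded_closed bounded_cball bounded_subset by blast
qed

lemma convex_cross_polytope: "convex (cross_polytope :: (real ^ 'n) set)"
proof -
  have "(\<Sum>i\<in>UNIV. \<bar>u * x $ i + v * y $ i\<bar>) \<le> 1"
    if "(\<Sum>i\<in>UNIV. \<bar>x $ i\<bar>) \<le> 1" "(\<Sum>i\<in>UNIV. \<bar>y $ i\<bar>) \<le> 1" "0 \<le> u" "0 \<le> v" "u + v = 1"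
    for x y :: "real ^ 'n" and u v :: real
  proof -
    have "(\<Sum>i\<in>UNIV. \<bar>u * x $ i + v * y $ i\<bar>) \<le> (\<Sum>i\<in>UNIV. u * \<bar>x $ i\<bar> + v * \<bar>y $ i\<bar>)"
      using that by (intro sum_mono) (metis abs_mult abs_of_nonneg abs_triangle_ineq)
    also have "\<dots> = u * (\<Sum>i\<in>UNIV. \<bar>x $ i\<bar>) + v * (\<Sum>i\<in>UNIV. \<bar>y $ i\<bar>)"
      by (simp add: sum.distrib sum_distrib_left)
    also have "\<dots> \<le> 1"
      using convex_bound_le[OF that] .
    finally show ?thesis .
  qed
  then show ?thesis
    by (auto simp: convex_def cross_polytope_def)
qed

text \<open>The \<open>2\<^sup>n\<close> reflections of the standard simplex, which has volume \<open>1 / n!\<close>, lie in the cross-polytope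
and overlap only in coordinate hyperplanes.\<close>

lemma measure_cross_polytope_ge:
  "2 ^ CARD('n) / fact CARD('n) \<le> measure lebesgue (cross_polytope :: (real ^ 'n) set)"
proof -
  define flip :: "'n set \<Rightarrow> real ^ 'n \<Rightarrow> real ^ 'n" where "flip I x = (\<chi> i. if i \<in> I then - x $ i else x $ i)" for I x
  define T0 :: "(real ^ 'n) set" where "T0 = convex hull (insert 0 Basis)"
  have T0: "T0 = {x. (\<forall>i. 0 \<le> x $ i) \<and> (\<Sum>i\<in>UNIV. x $ i) \<le> 1}"
    unfolding T0_def std_simplex
    by (auto simp: Basis_vec_def inner_axis sum.UNION_disjoint axis_eq_axis)
  have "compact T0"
    unfolding T0_def by (intro finite_imp_compact_convex_hull) simp
  then have T0_meas: "T0 \<in> lmeasurable" by (rule lmeasurable_compact)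
  have "measure lebesgue T0 = 1 / fact CARD('n)"
    using content_std_simplex[where 'a="real ^ 'n"] \<open>compact T0\<close> by (simp add: T0_def borel_compact)
  have lin: "linear (flip I)" for I
    by (rule linearI) (auto simp: flip_def vec_eq_iff)
  have invol: "flip I (flip I x) = x" for I x
    by (simp add: flip_def vec_eq_iff)
  have inj: "inj (flip I)" for I
    by (metis injI invol)
  \<comment> \<open>The reflections preserve this cube, hence preserve volume.\<close>
  let ?B = "cbox (- 1) (1 :: real ^ 'n)"
  have B: "compact ?B" "uminus ` ?B = ?B" "flip I ` ?B = ?B" "measure lebesgue ?B > 0" for I
  proof -
    have m: "- x \<in> ?B \<longleftrightarrow> x \<in> ?B" for x by (auto simp: mem_box_cart)
    show "uminus ` ?B = ?B"
      using m by (auto simp: image_iff)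
    have r: "flip I x \<in> ?B" if "x \<in> ?B" for x
      using that by (auto simp: mem_box_cart flip_def)
    show "flip I ` ?B = ?B"
      using r invol by (auto simp: image_iff) (metis)
    have "box (-1) (1 :: real ^ 'n) \<noteq> {}"
      by (auto simp: box_ne_empty Basis_vec_def inner_axis)
    then show "measure lebesgue ?B > 0"
      by (simp add: content_pos_lt_eq box_ne_empty)
  qed simp
  have T: "flip I ` T0 \<in> lmeasurable" "measure lebesgue (flip I ` T0) = 1 / fact CARD('n)" for I
    using linear_image_scales_measure[OF lin[of I] inj[of I] B(1,2,4) T0_meas] B(3)[of I] B(4)
      \<open>measure lebesgue T0 = 1 / fact CARD('n)\<close> by auto
  have "2 ^ CARD('n) / fact CARD('n) = (\<Sum>I::'n set\<in>UNIV. measure lebesgue (flip I ` T0))"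
    by (simp add: T Pow_UNIV[symmetric] card_Pow del: Pow_UNIV)
  also have "\<dots> = measure lebesgue (\<Union>I. flip I ` T0)"
  proof (rule measure_negligible_finite_Union_image[symmetric])
    show "pairwise (\<lambda>I J. negligible (flip I ` T0 \<inter> flip J ` T0)) UNIV"
    proof (rule pairwiseI)
      fix I J :: "'n set" assume "I \<noteq> J"
      then obtain i where i: "(i \<in> I) \<noteq> (i \<in> J)" by blast
      have "flip I ` T0 \<inter> flip J ` T0 \<subseteq> {x. x $ i = 0}"
      proof clarify
        fix x y assume "x \<in> T0" "y \<in> T0" "flip I x = flip J y"
        then have "flip I x $ i = flip J y $ i" "0 \<le> x $ i" "0 \<le> y $ i" by (auto simp: T0)
        then show "flip I x $ i = 0"
          using i by (auto simp: flip_def)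
      qed
      then show "negligible (flip I ` T0 \<inter> flip J ` T0)"
        using negligible_standard_hyperplane_cart negligible_subset by blast
    qed
  qed (use T in auto)
  also have "\<dots> \<le> measure lebesgue (cross_polytope :: (real ^ 'n) set)"
  proof (rule measure_mono_fmeasurable)
    show "(\<Union>I. flip I ` T0) \<subseteq> cross_polytope"
    proof clarify
      fix I x assume x: "x \<in> T0"
      then have "(\<Sum>i\<in>UNIV. \<bar>flip I x $ i\<bar>) = (\<Sum>i\<in>UNIV. x $ i)"
        by (intro sum.cong) (auto simp: flip_def T0)
      then show "flip I x \<in> cross_polytope" using x by (simp add: cross_polytope_def T0)
    qed
    show "(\<Union>I. flip I ` T0) \<in> sets lebesgue"
      using T by (intro sets.finite_UN) auto
    show "(cross_polytope :: (real ^ 'n) set) \<in> lmeasurable"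
      using compact_cross_polytope lmeasurable_compact by blast
  qed
  finally show ?thesis .
qed

lemma cross_polytope_image_subset_convex:
  fixes v :: "'n::finite \<Rightarrow> 'a::real_vector"
  assumes K: "convex K" and v: "\<And>i. v i \<in> K" "\<And>i. - v i \<in> K" and a: "a \<in> cross_polytope"
  shows "(\<Sum>i\<in>UNIV. a $ i *\<^sub>R v i) \<in> K"
proof -
  have zero: "0 \<in> K"
    using convexD_alt[OF K v(1) v(2), of "1/2" undefined undefined] by (simp add: algebra_simps)
  define s where "s = (\<Sum>i\<in>UNIV. \<bar>a $ i\<bar>)"
  have s: "0 \<le> s" "s \<le> 1"
    using a by (auto simp: s_def cross_polytope_def intro: sum_nonneg)
  show ?thesis
  proof (cases "s = 0")
    case True
    then have "a $ i = 0" for i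
      by (simp add: s_def sum_nonneg_eq_0_iff)
    then show ?thesis using zero by simp
  next
    case False
    \<comment> \<open>Dividing by the norm \<open>s\<close> gives a true convex combination \<open>p\<close>. If \<open>a $ i = 0\<close>, the second summand puts
        \<open>v i\<close> in place of the vector 0, so that all the vectors combined lie in \<open>K\<close>.\<close>
    define p where "p = (\<Sum>i\<in>UNIV. (\<bar>a $ i\<bar> / s) *\<^sub>R (sgn (a $ i) *\<^sub>R v i + (if a $ i = 0 then v i else 0)))"
    have "p \<in> K"
      unfolding p_def
    proof (rule convex_sum[OF _ K])
      show "(\<Sum>i\<in>UNIV. \<bar>a $ i\<bar> / s) = 1"
        using False by (simp add: sum_divide_distrib[symmetric] s_def[symmetric])
      show "sgn (a $ i) *\<^sub>R v i + (if a $ i = 0 then v i else 0) \<in> K" for i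
        using v[of i] by (auto simp: sgn_if)
    qed (use s in auto)
    then have "(1 - s) *\<^sub>R 0 + s *\<^sub>R p \<in> K"
      using convexD_alt[OF K zero _ s] by blast
    moreover have "s *\<^sub>R p = (\<Sum>i\<in>UNIV. a $ i *\<^sub>R v i)"
      unfolding p_def scaleR_sum_right using False
      by (intro sum.cong) (auto simp: abs_mult_sgn)
    ultimately show ?thesis by simp
  qed
qed

text \<open>An interior point can be scaled by some \<open>t > 1\<close> without leaving the cross-polytope.\<close>

lemma interior_cross_polytope_subset:
  "interior cross_polytope \<subseteq> {a :: real ^ 'n. (\<Sum>i\<in>UNIV. \<bar>a $ i\<bar>) < 1}"
proof
  fix a :: "real ^ 'n" assume a: "a \<in> interior cross_polytope"
  have "((\<lambda>t. t *\<^sub>R a) \<longlongrightarrow> 1 *\<^sub>R a) (at_right (1::real))"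
    by (intro tendsto_intros)
  then have ev: "\<forall>\<^sub>F t in at_right (1::real). t *\<^sub>R a \<in> interior cross_polytope"
    using a by (intro topological_tendstoD) auto
  have "\<forall>\<^sub>F t in at_right (1::real). t > 1"
    by (rule eventually_at_right_less)
  with ev have "\<forall>\<^sub>F t in at_right (1::real). t *\<^sub>R a \<in> interior cross_polytope \<and> t > 1"
    by (rule eventually_conj)
  then obtain t :: real where t: "t > 1" "t *\<^sub>R a \<in> interior cross_polytope"
    using eventually_happens' trivial_limit_at_right_real by blast
  then have "t *\<^sub>R a \<in> cross_polytope" using interior_subset by blast
  then have le: "t * (\<Sum>i\<in>UNIV. \<bar>a $ i\<bar>) \<le> 1"
    using t(1) by (simp add: cross_polytope_def abs_mult sum_distrib_left)
  have "(\<Sum>i\<in>UNIV. \<bar>a $ i\<bar>) < 1"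
  proof (rule ccontr)
    assume "\<not> (\<Sum>i\<in>UNIV. \<bar>a $ i\<bar>) < 1"
    then have "t * 1 \<le> t * (\<Sum>i\<in>UNIV. \<bar>a $ i\<bar>)"
      using t(1) by (intro mult_left_mono) auto
    then show False using le t(1) by linarith
  qed
  then show "a \<in> {a. (\<Sum>i\<in>UNIV. \<bar>a $ i\<bar>) < 1}" by simp
qed

lemma linear_combination_axis:
  fixes v :: "'n::finite \<Rightarrow> 'a::real_vector"
  shows "(\<Sum>j\<in>UNIV. (axis i 1 :: real ^ 'n) $ j *\<^sub>R v j) = v i"
proof -
  have "(\<Sum>j\<in>UNIV. (axis i 1 :: real ^ 'n) $ j *\<^sub>R v j) = (\<Sum>j\<in>UNIV. if j = i then v j else 0)"
    by (intro sum.cong) (auto simp: axis_def)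
  then show ?thesis by simp
qed

lemma linear_linear_combination:
  fixes v :: "'n::finite \<Rightarrow> 'a::real_vector"
  shows "linear (\<lambda>a :: real ^ 'n. \<Sum>i\<in>UNIV. a $ i *\<^sub>R v i)"
  by (rule linearI) (simp_all add: scaleR_add_left sum.distrib scaleR_sum_right)

lemma convex_hull_symmetric_eq_image_cross_polytope:
  fixes v :: "'n::finite \<Rightarrow> 'a::real_vector"
  shows "convex hull (range v \<union> uminus ` range v) = (\<lambda>a. \<Sum>i\<in>UNIV. a $ i *\<^sub>R v i) ` cross_polytope"
    (is "?H = ?f ` cross_polytope")
proof
  have "v i \<in> ?f ` cross_polytope" "- v i \<in> ?f ` cross_polytope" for i
  proof -
    have *: "axis i 1 \<in> cross_polytope" "- axis i (1::real) \<in> cross_polytope"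
      by (auto simp: cross_polytope_def axis_def if_distrib[where f=abs] cong: if_cong)
    show "v i \<in> ?f ` cross_polytope"
      using *(1) linear_combination_axis by (rule image_eqI[rotated, OF _ sym])
    show "- v i \<in> ?f ` cross_polytope"
      using *(2) by (rule image_eqI[rotated])
        (simp add: linear_neg[OF linear_linear_combination] linear_combination_axis del: vector_uminus_component)
  qed
  then show "?H \<subseteq> ?f ` cross_polytope"
    by (intro hull_minimal convex_linear_image linear_linear_combination convex_cross_polytope) auto
  show "?f ` cross_polytope \<subseteq> ?H"
  proof clarify
    fix a :: "real ^ 'n" assume "a \<in> cross_polytope"
    then show "?f a \<in> ?H"
      by (intro cross_polytope_image_subset_convex convex_convex_hull) (auto intro: hull_inc)
  qed
qed

section \<open>Symmetric polytopes with the least number of vertices\<close>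

lemma extreme_point_of_uminus:
  fixes P :: "'a::euclidean_space set"
  assumes P: "uminus ` P = P" and x: "x extreme_point_of P"
  shows "- x extreme_point_of P"
  unfolding extreme_point_of_def
proof (intro conjI ballI notI)
  have minusP: "- y \<in> P" if "y \<in> P" for y
    using P that by blast
  show "- x \<in> P"
    using x minusP by (simp add: extreme_point_of_def)
  fix a b assume ab: "a \<in> P" "b \<in> P" "- x \<in> open_segment a b"
  have "linear (uminus :: 'a \<Rightarrow> 'a)" "inj (uminus :: 'a \<Rightarrow> 'a)"
    by (auto intro: linearI)
  from open_segment_linear_image[OF this, of a b] ab(3)
  have "x \<in> open_segment (- a) (- b)"
    by (metis image_eqI minus_minus)
  then show False
    using x minusP ab(1,2) by (auto simp: extreme_point_of_def)
qed

lemma zero_not_extreme_point_of_symmetric: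
  fixes P :: "'a::real_vector set"
  assumes P: "uminus ` P = P" and x: "x \<in> P" "x \<noteq> 0"
  shows "\<not> 0 extreme_point_of P"
proof
  assume "0 extreme_point_of P"
  moreover have "0 \<in> open_segment x (- x)"
  proof -
    have "x \<noteq> - x"
    proof
      assume "x = - x"
      then have "2 *\<^sub>R x = 0" by (metis scaleR_2 add.right_inverse)
      then show False using x(2) by simp
    qed
    moreover have "0 = (1 - 1/2) *\<^sub>R x + (1/2) *\<^sub>R (- x)" by simp
    ultimately show ?thesis
      unfolding in_segment by (intro conjI exI[of _ "1/2"]) auto
  qed
  moreover have "- x \<in> P" using P x(1) by blast
  ultimately show False using x(1) by (auto simp: extreme_point_of_def)
qed

text \<open>A basis \<open>B\<close> chosen inside \<open>W\<close> cannot contain both \<open>b\<close> and \<open>-b\<close>. So \<open>B\<close> and \<open>-B\<close> are disjoint subsets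
of \<open>W\<close> with \<open>n\<close> elements each, and they exhaust \<open>W\<close> by cardinality.\<close>

lemma symmetric_spanning_set_eq_basis_Un:
  fixes W :: "(real ^ 'n) set"
  assumes W: "finite W" "card W = 2 * CARD('n)" "uminus ` W = W" "0 \<notin> W" and span: "span W = UNIV"
  obtains v :: "'n \<Rightarrow> real ^ 'n" where "W = range v \<union> uminus ` range v" "span (range v) = UNIV"
proof -
  obtain B where B: "B \<subseteq> W" "independent B" "W \<subseteq> span B"
    using maximal_independent_subset by blast
  have spB: "span B = UNIV"
    using B(3) span span_minimal subspace_span by blast
  have "card B = CARD('n)"
    using B(2) spB dim_span_eq_card_independent by fastforce
  have finB: "finite B" using B(1) W(1) finite_subset by blast
  have "B \<inter> uminus ` B = {}"
  proof (rule ccontr)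
    assume "B \<inter> uminus ` B \<noteq> {}"
    then obtain b where b: "b \<in> B" "- b \<in> B" by blast
    then have "b \<noteq> 0" using B W by blast
    then have "b \<noteq> - b" by (auto simp: vec_eq_iff)
    then have "- b \<in> span (B - {- b})"
      using b by (intro span_neg span_base) auto
    then show False
      using B(2) b by (auto simp: dependent_def)
  qed
  then have "card (B \<union> uminus ` B) = card W"
    using finB W(2) \<open>card B = CARD('n)\<close> by (simp add: card_Un_disjoint card_image)
  moreover have "B \<union> uminus ` B \<subseteq> W"
    using B(1) W(3) by blast
  ultimately have "W = B \<union> uminus ` B"
    using W(1) by (metis card_subset_eq)
  moreover obtain v :: "'n \<Rightarrow> real ^ 'n" where "bij_betw v UNIV B"
    using finB \<open>card B = CARD('n)\<close> finite_same_card_bij[of "UNIV :: 'n set" B] by auto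
  ultimately show thesis
    using that[of v] spB by (simp add: bij_betw_def)
qed

theorem proposition1p4:
  fixes P :: "(real ^ 'n) set"
  assumes "P \<in> symmetric_lattice_polytopes"
    and "card (vertices P) = 2 * CARD('n)"
  shows "measure lebesgue P
           \<ge> 2 ^ (CARD('n) - 1) / fact CARD('n) * (real (lattice_point_count (interior P)) + 1)"
proof -
  let ?W = "vertices P" and ?C = "cross_polytope :: (real ^ 'n) set"
  let ?U = "half_open_unit_cube :: (real ^ 'n) set"
  have P: "polytope P" "?W \<subseteq> integer_lattice" "aff_dim P = int CARD('n)" "uminus ` P = P"
    using assms(1) by (auto simp: symmetric_lattice_polytopes_def lattice_polytope_def)
  have finW: "finite ?W"
    by (rule card_ge_0_finite) (simp add: assms(2))
  have hull: "P = convex hull ?W"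
    unfolding vertices_def
    by (rule Krein_Milman_Minkowski[OF polytope_imp_compact[OF P(1)] polytope_imp_convex[OF P(1)]])
  have symW: "uminus ` ?W = ?W"
  proof -
    have "- x \<in> ?W" if "x \<in> ?W" for x
      using that extreme_point_of_uminus[OF P(4)] by (simp add: vertices_def)
    then show ?thesis by (metis image_eqI minus_minus subsetI subset_antisym image_subsetI)
  qed
  have "affine hull P = UNIV"
    using P(3) aff_dim_eq_full[of P] by simp
  then have "affine hull ?W = UNIV"
    by (metis hull affine_hull_convex_hull)
  then have spanW: "span ?W = UNIV"
    using affine_hull_subset_span[of ?W] by auto
  have "\<not> ?W \<subseteq> {0}"
  proof
    assume "?W \<subseteq> {0}"
    then have "card ?W \<le> 1" using card_mono[of "{0}" ?W] by simp
    then show False using assms(2) zero_less_card_finite[where 'a='n] by linarith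
  qed
  then obtain x where "x \<in> P" "x \<noteq> 0"
    by (auto simp: vertices_def extreme_point_of_def)
  then have zero: "0 \<notin> ?W"
    using zero_not_extreme_point_of_symmetric[OF P(4)] by (simp add: vertices_def)
  obtain v :: "'n \<Rightarrow> real ^ 'n" where v: "?W = range v \<union> uminus ` range v" "span (range v) = UNIV"
    using symmetric_spanning_set_eq_basis_Un[OF finW assms(2) symW zero spanW] .
  define f :: "real ^ 'n \<Rightarrow> real ^ 'n" where "f a = (\<Sum>i\<in>UNIV. a $ i *\<^sub>R v i)" for a
  have lin: "linear f"
    unfolding f_def by (rule linear_linear_combination)
  have "v i = f (axis i 1)" for i
    unfolding f_def by (rule linear_combination_axis[symmetric])
  then have "range v \<subseteq> range f" by blast
  then have "surj f"
    using v(2) span_minimal[of "range v" "range f"] linear_subspace_image[OF lin subspace_UNIV] by blast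
  then have inj: "inj f"
    using lin linear_surjective_imp_injective by blast
  have P_eq: "P = f ` ?C"
    unfolding f_def using hull v(1) convex_hull_symmetric_eq_image_cross_polytope[of v] by simp
  have lattice: "f ` integer_lattice \<subseteq> integer_lattice"
  proof clarify
    fix a :: "real ^ 'n" assume a: "a \<in> integer_lattice"
    have "v i \<in> integer_lattice" for i using P(2) v(1) by auto
    then show "f a \<in> integer_lattice"
      using a by (auto simp: f_def integer_lattice_def intro!: Ints_sum Ints_mult)
  qed
  have int: "interior P \<subseteq> f ` {a. (\<Sum>i\<in>UNIV. \<bar>a $ i\<bar>) < 1}"
    unfolding P_eq interior_injective_linear_image[OF lin inj]
    by (intro image_mono interior_cross_polytope_subset)
  have symC: "uminus ` ?C = ?C"
  proof -
    have "- a \<in> ?C" if "a \<in> ?C" for a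
      using that by (simp add: cross_polytope_def)
    then show ?thesis by (metis image_eqI minus_minus subsetI subset_antisym image_subsetI)
  qed
  have posC: "measure lebesgue ?C > 0"
    by (rule less_le_trans[OF _ measure_cross_polytope_ge]) simp
  \<comment> \<open>The standard cross-polytope itself serves as the symmetric reference body.\<close>
  note cell = linear_image_scales_measure
    [OF lin inj compact_cross_polytope symC posC half_open_unit_cube_lmeasurable]
  have vol: "measure lebesgue P = measure lebesgue ?C * measure lebesgue (f ` ?U)"
    using cell(2) posC by (simp add: measure_half_open_unit_cube P_eq)
  let ?S = "interior P \<inter> integer_lattice"
  \<comment> \<open>If the set were infinite, its cardinality would be 0 by convention and the empty set would give the bound.\<close>
  have count: "real (card ?S) + 1 \<le> 2 * measure lebesgue (f ` ?U)"
  proof (cases "finite ?S")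
    case True
    then show ?thesis
      using int by (intro card_interior_lattice_points_le[OF lin inj cell(1) lattice]) auto
  next
    case False
    then show ?thesis
      using card_interior_lattice_points_le[OF lin inj cell(1) lattice, of "{}"] by simp
  qed
  have "2 ^ (CARD('n) - 1) / fact CARD('n) * (real (card ?S) + 1)
      \<le> 2 ^ (CARD('n) - 1) / fact CARD('n) * (2 * measure lebesgue (f ` ?U))"
    using count by (intro mult_left_mono) auto
  also have "\<dots> = 2 ^ CARD('n) / fact CARD('n) * measure lebesgue (f ` ?U)"
    by (simp add: power_eq_if)
  also have "\<dots> \<le> measure lebesgue ?C * measure lebesgue (f ` ?U)"
    by (intro mult_right_mono measure_cross_polytope_ge) simp
  finally show ?thesis by (simp add: lattice_point_count_def vol)
qed

end
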